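(* Let $d\geq 2$ and $m\geq 3$ be integers and let $\boldsymbol{A}\in\mathbb{R}^{m\times d}$. Then $$\beta_{\boldsymbol{A}}\geq \frac{1}{\sqrt{1-\frac{1}{m\cdot\sin\frac{\pi}{2m}}}}.$$
   Context: For $\boldsymbol{x},\boldsymbol{y}\in\mathbb{R}^d$ set $\mathrm{dist}(\boldsymbol{x},\boldsymbol{y}):=\min\{\|\boldsymbol{x}-\boldsymbol{y}\|_2,\|\boldsymbol{x}+\boldsymbol{y}\|_2\}$. For $\boldsymbol{A}\in\mathbb{R}^{m\times d}$, $|\boldsymbol{A}\boldsymbol{x}|\in\mathbb{R}_+^m$ denotes the vector of entrywise absolute values of $\boldsymbol{A}\boldsymbol{x}$. Define $$L_{\boldsymbol{A}}:=\inf_{\boldsymbol{x},\boldsymbol{y}\in\mathbb{R}^d,\ \mathrm{dist}(\boldsymbol{x},\boldsymbol{y})\neq 0}\frac{\||\boldsymbol{A}\boldsymbol{x}|-|\boldsymbol{A}\boldsymbol{y}|\|_2}{\mathrm{dist}(\boldsymbol{x},\boldsymbol{y})},\qquad U_{\boldsymbol{A}}:=\sup_{\boldsymbol{x},\boldsymbol{y}\in\mathbb{R}^d,\ \mathrm{dist}(\boldsymbol{x},\boldsymbol{y})\neq 0}\frac{\||\boldsymbol{A}\boldsymbol{x}|-|\boldsymbol{A}\boldsymbol{y}|\|_2}{\mathrm{dist}(\boldsymbol{x},\boldsymbol{y})}.$$ The condition number is $\beta_{\boldsymbol{A}}:=U_{\boldsymbol{A}}/L_{\boldsymbol{A}}$,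 with the convention $\beta_{\boldsymbol{A}}=+\infty$ if $L_{\boldsymbol{A}}=0$. *)

theory Defs
  imports "HOL-Analysis.Analysis"
begin

definition sign_dist :: "real^'d \<Rightarrow> real^'d \<Rightarrow> real" where
  "sign_dist x y = min (norm (x - y)) (norm (x + y))"

definition abs_meas :: "real^'d^'m \<Rightarrow> real^'d \<Rightarrow> real^'m" where
  "abs_meas A x = (\<chi> i. \<bar>(A *v x) $ i\<bar>)"

(* The infimum and supremum are taken in the extended reals, so that they are
   unconditionally the true infimum and supremum of the set of quotients. *)

definition lower_lip :: "real^'d^'m \<Rightarrow> ereal" where
  "lower_lip A =
     (INF (x, y) \<in> {(x, y). sign_dist x y \<noteq> 0}.
        ereal (norm (abs_meas A x - abs_meas A y) / sign_dist x y))"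

definition upper_lip :: "real^'d^'m \<Rightarrow> ereal" where
  "upper_lip A =
     (SUP (x, y) \<in> {(x, y). sign_dist x y \<noteq> 0}.
        ereal (norm (abs_meas A x - abs_meas A y) / sign_dist x y))"

(* The case distinction matters for A = 0, where upper_lip A / lower_lip A would be
   0 / 0 = 0 in type ereal. *)

definition cond_number :: "real^'d^'m \<Rightarrow> ereal" where
  "cond_number A = (if lower_lip A = 0 then \<infinity> else upper_lip A / lower_lip A)"

end

theory Submission
  imports Defs
begin

text \<open>
  Choose a coordinate plane, let \<open>v, w\<close> be an orthonormal basis of it, and write \<open>p\<^sub>i, q\<^sub>i\<close> for the
  inner products of the \<open>i\<close>-th row with \<open>v, w\<close>. The pair \<open>v + w, v - w\<close> bounds the squared lower
  constant by \<open>\<Sum> min (p\<^sub>i\<^sup>2) (q\<^sub>i\<^sup>2) = (T - \<Sum> \<bar>p\<^sub>i\<^sup>2 - q\<^sub>i\<^sup>2\<bar>) / 2\<close> with \<open>T = \<Sum> (p\<^sub>i\<^sup>2 + q\<^sub>i\<^sup>2)\<close>, and the pairs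
  \<open>v, 0\<close> and \<open>w, 0\<close> bound the squared upper constant from below by \<open>T / 2\<close>.
  If \<open>v\<close> has angle \<open>t / 2\<close> then \<open>p\<^sub>i\<^sup>2 - q\<^sub>i\<^sup>2 = r\<^sub>i cos (\<theta>\<^sub>i - t)\<close> with \<open>\<Sum> r\<^sub>i = T\<close>, so a \<open>t\<close> is needed
  for which \<open>\<Sum> r\<^sub>i \<bar>cos (\<theta>\<^sub>i - t)\<bar>\<close> is at least \<open>T / (m sin (\<pi> / 2m))\<close>. This amounts to Reinhardt's
  bound for the perimeter of a centrally symmetric polygon with \<open>2m\<close> sides, and follows by
  averaging: with \<open>\<phi>\<^sub>0 \<le> \<dots> \<le> \<phi>\<^sub>m = \<phi>\<^sub>0 + \<pi>\<close> the zeros of the \<open>m\<close> cosines, give the midpoint of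
  \<open>[\<phi>\<^sub>k, \<phi>\<^sub>k\<^sub>+\<^sub>1]\<close> the weight \<open>sin ((\<phi>\<^sub>k\<^sub>+\<^sub>1 - \<phi>\<^sub>k) / 2)\<close>. Each \<open>\<bar>cos (\<theta>\<^sub>i - t)\<bar>\<close> then has weighted sum
  at least \<open>1\<close>, because the increments of \<open>sin\<close> telescope, and by concavity the total weight is
  at most \<open>m sin (\<pi> / 2m)\<close>.
\<close>

section \<open>Averaging over a half period\<close>

lemma concave_on_sin: "concave_on {0..pi} sin"
proof (rule f''_le0_imp_concave)
  fix x :: real assume "x \<in> {0..pi}"
  then show "- sin x \<le> 0" by (simp add: sin_ge_zero)
qed (auto intro!: derivative_eq_intros)

text \<open>Jensen's inequality with equal weights; it will bound the total weight of the
  midpoints.\<close>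

lemma sum_sin_le:
  fixes y :: "'a \<Rightarrow> real"
  assumes "finite S" "S \<noteq> {}" and y: "\<And>i. i \<in> S \<Longrightarrow> y i \<in> {0..pi}"
  shows "(\<Sum>i\<in>S. sin (y i)) \<le> card S * sin ((\<Sum>i\<in>S. y i) / card S)"
proof -
  have pos: "real (card S) > 0" using assms by (simp add: card_gt_0_iff)
  have "(\<Sum>i\<in>S. 1 / card S * sin (y i)) \<le> sin (\<Sum>i\<in>S. (1 / card S) *\<^sub>R y i)"
    using concave_on_sum[OF assms(1,2) concave_on_sin, of "\<lambda>_. 1 / card S" y] pos y by simp
  then show ?thesis
    using pos by (simp add: sum_divide_distrib[symmetric] field_simps)
qed

lemma abs_diff_le_sum_increments:
  fixes g :: "nat \<Rightarrow> real"
  assumes "a \<le> b"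
  shows "\<bar>g b - g a\<bar> \<le> (\<Sum>k=a..<b. \<bar>g (Suc k) - g k\<bar>)"
  using sum_abs[of "\<lambda>k. g (Suc k) - g k" "{a..<b}"] sum_Suc_diff'[OF assms, of g] by simp

text \<open>The values of \<open>sin\<close> at the two ends are opposite, so their distances to \<open>\<plusminus>1\<close> add up to \<open>2\<close>.\<close>

lemma variation_sin_half_period:
  fixes \<phi> :: "nat \<Rightarrow> real"
  assumes "i \<le> m" and "\<phi> m = \<phi> 0 + pi" and "\<bar>sin (\<phi> i - \<theta>)\<bar> = 1"
  shows "2 \<le> (\<Sum>k<m. \<bar>sin (\<phi> (Suc k) - \<theta>) - sin (\<phi> k - \<theta>)\<bar>)"
proof -
  define g where "g k = sin (\<phi> k - \<theta>)" for k
  have "g m = - g 0"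
    using assms(2) sin_periodic_pi[of "\<phi> 0 - \<theta>"] by (simp add: g_def algebra_simps)
  moreover have "\<bar>g i\<bar> = 1" using assms(3) by (simp add: g_def)
  ultimately have "2 \<le> \<bar>g i - g 0\<bar> + \<bar>g m - g i\<bar>" by linarith
  also have "\<dots> \<le> (\<Sum>k=0..<i. \<bar>g (Suc k) - g k\<bar>) + (\<Sum>k=i..<m. \<bar>g (Suc k) - g k\<bar>)"
    using assms(1) by (intro add_mono abs_diff_le_sum_increments) auto
  also have "\<dots> = (\<Sum>k<m. \<bar>g (Suc k) - g k\<bar>)"
    using assms(1) by (simp add: sum.atLeastLessThan_concat lessThan_atLeast0)
  finally show ?thesis by (simp add: g_def)
qed

text \<open>The remainder of \<open>\<theta> + pi / 2\<close> modulo \<open>pi\<close> works: it is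
  the zero in the half period of the cosine centred at \<theta>.\<close>

lemma ex_abs_sin_diff_eq_1:
  fixes \<theta> :: real
  shows "\<exists>\<psi>. 0 \<le> \<psi> \<and> \<psi> < pi \<and> \<bar>sin (\<psi> - \<theta>)\<bar> = 1"
proof -
  define n where "n = \<lfloor>(\<theta> + pi / 2) / pi\<rfloor>"
  define \<psi> where "\<psi> = \<theta> + pi / 2 - pi * of_int n"
  have "of_int n \<le> (\<theta> + pi / 2) / pi" "(\<theta> + pi / 2) / pi < of_int n + 1"
    unfolding n_def by linarith+
  then have "of_int n * pi \<le> \<theta> + pi / 2" "\<theta> + pi / 2 < (of_int n + 1) * pi"
    by (simp_all add: pos_le_divide_eq pos_divide_less_eq)
  then have "0 \<le> \<psi>" "\<psi> < pi" by (simp_all add: \<psi>_def algebra_simps)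
  moreover have "sin (\<psi> - \<theta>) = cos (pi * of_int n)"
    by (simp add: \<psi>_def sin_diff)
  then have "\<bar>sin (\<psi> - \<theta>)\<bar> = 1" by (simp add: cos_npi_int)
  ultimately show ?thesis by blast
qed

text \<open>Coincident zeros are kept with multiplicity, so there are exactly \<open>card I\<close>
  gaps, some possibly of length 0, and their lengths add up to \<open>pi\<close>.\<close>

lemma ex_sorted_half_period:
  fixes \<psi> :: "'a \<Rightarrow> real"
  assumes "finite I" "I \<noteq> {}" and \<psi>: "\<And>i. i \<in> I \<Longrightarrow> 0 \<le> \<psi> i \<and> \<psi> i < pi"
  obtains \<phi> :: "nat \<Rightarrow> real"
  where "\<phi> (card I) = \<phi> 0 + pi"
    and "\<And>k. k < card I \<Longrightarrow> \<phi> k \<le> \<phi> (Suc k)"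
    and "\<And>i. i \<in> I \<Longrightarrow> \<exists>k<card I. \<phi> k = \<psi> i"
proof -
  obtain l where l: "distinct l" "set l = I" using assms(1) finite_distinct_list by blast
  define xs where "xs = sort (map \<psi> l)"
  have len: "length xs = card I" using l distinct_card by (fastforce simp: xs_def)
  have set_xs: "set xs = \<psi> ` I" by (simp add: xs_def l)
  have card: "card I > 0" using assms by (simp add: card_gt_0_iff)
  \<comment> \<open>The index \<open>card I\<close> wraps around to the smallest point shifted by
    \<open>pi\<close>.\<close>
  define \<phi> where "\<phi> k = (if k < card I then xs ! k else xs ! 0 + pi)" for k
  show ?thesis
  proof
    show "\<phi> (card I) = \<phi> 0 + pi" using card by (simp add: \<phi>_def)
    show "\<phi> k \<le> \<phi> (Suc k)" if "k < card I" for k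
    proof (cases "Suc k < card I")
      case True
      then show ?thesis
        using that len sorted_nth_mono[of xs k "Suc k"] by (simp add: \<phi>_def xs_def)
    next
      case False
      have "xs ! k \<in> \<psi> ` I" "xs ! 0 \<in> \<psi> ` I"
        using that len set_xs card nth_mem by metis+
      then have "xs ! k < pi" "0 \<le> xs ! 0" using \<psi> by auto
      then show ?thesis using that False by (simp add: \<phi>_def)
    qed
    show "\<exists>k<card I. \<phi> k = \<psi> i" if "i \<in> I" for i
    proof -
      have "\<psi> i \<in> set xs" using that set_xs by simp
      then show ?thesis using len by (auto simp: in_set_conv_nth \<phi>_def)
    qed
  qed
qed

lemma ex_direction_sum_abs_cos_ge:
  fixes r \<theta> :: "'a \<Rightarrow> real"
  assumes "finite I" "I \<noteq> {}" and r: "\<And>i. i \<in> I \<Longrightarrow> 0 \<le> r i"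
  shows "\<exists>t. (\<Sum>i\<in>I. r i) \<le>
    (\<Sum>i\<in>I. r i * \<bar>cos (\<theta> i - t)\<bar>) * (real (card I) * sin (pi / (2 * real (card I))))"
proof -
  obtain \<psi> where \<psi>: "\<And>i. 0 \<le> \<psi> i \<and> \<psi> i < pi \<and> \<bar>sin (\<psi> i - \<theta> i)\<bar> = 1"
    using choice[of "\<lambda>i \<psi>. 0 \<le> \<psi> \<and> \<psi> < pi \<and> \<bar>sin (\<psi> - \<theta> i)\<bar> = 1"] ex_abs_sin_diff_eq_1
    by blast
  define m where "m = card I"
  have m: "m > 0" using assms by (simp add: m_def card_gt_0_iff)
  obtain \<phi> :: "nat \<Rightarrow> real" where per: "\<phi> m = \<phi> 0 + pi"
    and incr: "\<And>k. k < m \<Longrightarrow> \<phi> k \<le> \<phi> (Suc k)"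
    and hit: "\<And>i. i \<in> I \<Longrightarrow> \<exists>k<m. \<phi> k = \<psi> i"
    using ex_sorted_half_period[OF assms(1,2), of \<psi>] \<psi> unfolding m_def by metis
  define mid where "mid k = (\<phi> (Suc k) + \<phi> k) / 2" for k
  define h where "h k = (\<phi> (Suc k) - \<phi> k) / 2" for k
  define f where "f t = (\<Sum>i\<in>I. r i * \<bar>cos (\<theta> i - t)\<bar>)" for t
  have sum_h: "(\<Sum>k<m. h k) = pi / 2"
    using per by (simp add: h_def sum_divide_distrib[symmetric] sum_lessThan_telescope)
  have h0: "0 \<le> h k" if "k < m" for k using incr[OF that] by (simp add: h_def)
  have h_pi: "h k \<in> {0..pi}" if "k < m" for k
  proof -
    have "h k \<le> (\<Sum>k<m. h k)" using that h0 by (intro member_le_sum) auto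
    then show ?thesis using h0[OF that] sum_h pi_gt_zero by simp
  qed
  have sin_h: "0 \<le> sin (h k)" if "k < m" for k
    using h_pi[OF that] by (simp add: sin_ge_zero)
  have one: "1 \<le> (\<Sum>k<m. sin (h k) * \<bar>cos (\<theta> i - mid k)\<bar>)" if "i \<in> I" for i
  proof -
    obtain j where j: "j < m" "\<phi> j = \<psi> i" using hit[OF \<open>i \<in> I\<close>] by blast
    have "2 \<le> (\<Sum>k<m. \<bar>sin (\<phi> (Suc k) - \<theta> i) - sin (\<phi> k - \<theta> i)\<bar>)"
      using j \<psi> per by (intro variation_sin_half_period[of j]) auto
    also have "\<dots> = (\<Sum>k<m. 2 * (sin (h k) * \<bar>cos (\<theta> i - mid k)\<bar>))"
    proof (rule sum.cong)
      fix k assume "k \<in> {..<m}"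
      then have "0 \<le> sin (h k)" using sin_h by simp
      \<comment> \<open>By sum-to-product, an increment of \<open>sin\<close> is twice the weight of
        the gap times the cosine at its midpoint, up to sign.\<close>
      have *: "(\<phi> (Suc k) - \<theta> i - (\<phi> k - \<theta> i)) / 2 = h k"
        "(\<phi> (Suc k) - \<theta> i + (\<phi> k - \<theta> i)) / 2 = - (\<theta> i - mid k)"
        by (simp_all add: h_def mid_def field_simps)
      show "\<bar>sin (\<phi> (Suc k) - \<theta> i) - sin (\<phi> k - \<theta> i)\<bar> = 2 * (sin (h k) * \<bar>cos (\<theta> i - mid k)\<bar>)"
        using \<open>0 \<le> sin (h k)\<close> unfolding sin_diff_sin * cos_minus by (simp add: abs_mult)
    qed simp
    finally show ?thesis by (simp add: sum_distrib_left[symmetric])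
  qed
  \<comment> \<open>The best midpoint dominates the weighted average and serves as the direction
    \<open>t\<close>.\<close>
  define D where "D = Max ((\<lambda>k. f (mid k)) ` {..<m})"
  have "D \<in> (\<lambda>k. f (mid k)) ` {..<m}" using m unfolding D_def by (intro Max_in) auto
  then obtain k0 where k0: "D = f (mid k0)" by auto
  have "0 \<le> D" unfolding k0 f_def using r by (intro sum_nonneg) simp
  have "(\<Sum>i\<in>I. r i) \<le> (\<Sum>i\<in>I. r i * (\<Sum>k<m. sin (h k) * \<bar>cos (\<theta> i - mid k)\<bar>))"
    using mult_left_mono[OF one r] by (intro sum_mono) (simp only: mult_1_right)
  also have "\<dots> = (\<Sum>k<m. sin (h k) * f (mid k))"
    unfolding f_def sum_distrib_left by (subst sum.swap) (simp add: mult_ac)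
  also have "\<dots> \<le> (\<Sum>k<m. sin (h k) * D)"
    using sin_h by (intro sum_mono mult_left_mono) (auto simp: D_def)
  also have "\<dots> = D * (\<Sum>k<m. sin (h k))" by (simp add: sum_distrib_left mult.commute)
  also have "\<dots> \<le> D * (real m * sin (pi / (2 * real m)))"
    using sum_sin_le[of "{..<m}" h] m h_pi sum_h \<open>0 \<le> D\<close>
    by (intro mult_left_mono) auto
  finally show ?thesis unfolding k0 f_def m_def by blast
qed

section \<open>Bounds for the Lipschitz constants and the condition number\<close>

lemma lower_lip_le:
  assumes "sign_dist x y \<noteq> 0"
  shows "lower_lip A \<le> ereal (norm (abs_meas A x - abs_meas A y) / sign_dist x y)"
  unfolding lower_lip_def using assms by (intro INF_lower2[of "(x, y)"]) auto

lemma upper_lip_ge: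
  assumes "sign_dist x y \<noteq> 0"
  shows "ereal (norm (abs_meas A x - abs_meas A y) / sign_dist x y) \<le> upper_lip A"
  unfolding upper_lip_def using assms by (intro SUP_upper2[of "(x, y)"]) auto

lemma lower_lip_nonneg: "0 \<le> lower_lip A"
  unfolding lower_lip_def sign_dist_def by (intro INF_greatest) auto

lemma norm_abs_meas: "norm (abs_meas A x) = norm (A *v x)"
  by (simp add: norm_vec_def abs_meas_def)

lemma norm_matrix_vector_le_upper_lip:
  assumes "norm v = 1"
  shows "ereal (norm (A *v v)) \<le> upper_lip A"
proof -
  have "abs_meas A 0 = 0" by (simp add: abs_meas_def vec_eq_iff)
  then show ?thesis
    using upper_lip_ge[of v 0 A] assms by (simp add: sign_dist_def norm_abs_meas)
qed

text \<open>Both sides equal four times the smaller of \<open>p\<^sup>2\<close> and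
  \<open>q\<^sup>2\<close>; this form separates the total from the differences when summed over the
  rows.\<close>

lemma power2_abs_add_minus_abs_diff:
  fixes p q :: real
  shows "(\<bar>p + q\<bar> - \<bar>p - q\<bar>)\<^sup>2 = 2 * ((p\<^sup>2 + q\<^sup>2) - \<bar>p\<^sup>2 - q\<^sup>2\<bar>)"
proof -
  have "\<bar>p + q\<bar> * \<bar>p - q\<bar> = \<bar>p\<^sup>2 - q\<^sup>2\<bar>"
    by (simp add: abs_mult[symmetric] power2_eq_square algebra_simps)
  moreover have "(\<bar>p + q\<bar> - \<bar>p - q\<bar>)\<^sup>2 = (p + q)\<^sup>2 + (p - q)\<^sup>2 - 2 * (\<bar>p + q\<bar> * \<bar>p - q\<bar>)"
    by (simp add: power2_diff)
  ultimately show ?thesis by (simp add: power2_sum power2_diff)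
qed

lemma lower_lip_le_orthonormal:
  fixes A :: "real^'d^'m" and v w :: "real^'d"
  assumes "norm v = 1" "norm w = 1"
  defines "p \<equiv> \<lambda>i. (A *v v) $ i" and "q \<equiv> \<lambda>i. (A *v w) $ i"
  shows "lower_lip A \<le>
    ereal (sqrt ((\<Sum>i\<in>UNIV. (p i)\<^sup>2 + (q i)\<^sup>2 - \<bar>(p i)\<^sup>2 - (q i)\<^sup>2\<bar>) / 2))"
proof -
  \<comment> \<open>Both candidates in the minimum defining \<open>sign_dist\<close> have norm
    2.\<close>
  have "v + w - (v - w) = 2 *\<^sub>R w" "v + w + (v - w) = 2 *\<^sub>R v"
    by (simp_all add: scaleR_2)
  then have dist: "sign_dist (v + w) (v - w) = 2"
    using assms by (simp add: sign_dist_def)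
  have comp: "(abs_meas A (v + w) - abs_meas A (v - w)) $ i = \<bar>p i + q i\<bar> - \<bar>p i - q i\<bar>" for i
    by (simp add: abs_meas_def p_def q_def matrix_vector_right_distrib
        matrix_vector_mult_diff_distrib)
  have "norm (abs_meas A (v + w) - abs_meas A (v - w)) / 2 =
      sqrt ((\<Sum>i\<in>UNIV. (\<bar>p i + q i\<bar> - \<bar>p i - q i\<bar>)\<^sup>2) / 4)"
    unfolding norm_vec_def L2_set_def comp by (simp add: real_sqrt_divide)
  also have "\<dots> = sqrt ((\<Sum>i\<in>UNIV. (p i)\<^sup>2 + (q i)\<^sup>2 - \<bar>(p i)\<^sup>2 - (q i)\<^sup>2\<bar>) / 2)"
    unfolding power2_abs_add_minus_abs_diff by (simp only: sum_distrib_left[symmetric]) simp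
  finally show ?thesis using lower_lip_le[of "v + w" "v - w" A] dist by simp
qed

text \<open>Reduces the claim to real numbers. A vanishing lower constant makes the condition number
  infinite, and otherwise \<open>l\<close> is positive, so the ratio is compared only for
  \<open>0 < l\<close>.\<close>

lemma cond_number_ge:
  assumes "lower_lip A \<le> ereal l" and "ereal u \<le> upper_lip A" and "0 \<le> u"
    and "0 < l \<Longrightarrow> c \<le> u / l"
  shows "ereal c \<le> cond_number A"
proof (cases "lower_lip A = 0")
  case True
  then show ?thesis by (simp add: cond_number_def)
next
  case False
  then have pos: "0 < lower_lip A" using lower_lip_nonneg[of A] by simp
  then obtain l' where l': "lower_lip A = ereal l'" "0 < l'" "l' \<le> l"
    using assms(1) by (cases "lower_lip A") auto
  have "c \<le> u / l'"
    using assms(3,4) l' frac_le[of u u l' l] by linarith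
  then have "ereal c \<le> ereal u / lower_lip A" using l' by simp
  also have "\<dots> \<le> upper_lip A / lower_lip A"
    using assms(2) l' by (intro ereal_divide_right_mono) auto
  finally show ?thesis using False by (simp add: cond_number_def)
qed

lemma ex_orthonormal_sum_abs_diff_ge:
  fixes A :: "real^'d^'m"
  assumes "CARD('d) \<ge> 2"
  obtains v w :: "real^'d" where "norm v = 1" "norm w = 1"
    "(\<Sum>i\<in>UNIV. ((A *v v) $ i)\<^sup>2 + ((A *v w) $ i)\<^sup>2) \<le>
      (\<Sum>i\<in>UNIV. \<bar>((A *v v) $ i)\<^sup>2 - ((A *v w) $ i)\<^sup>2\<bar>)
        * (real CARD('m) * sin (pi / (2 * real CARD('m))))"
proof -
  obtain j k :: 'd where jk: "j \<noteq> k"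
    using assms by (metis card_2_iff' ex_card)
  have "\<forall>i. \<exists>\<rho> \<eta>. A $ i $ j = \<rho> * cos \<eta> \<and> A $ i $ k = \<rho> * sin \<eta>"
    using polar_Ex by blast
  then obtain \<rho> \<eta> where polar: "\<And>i. A $ i $ j = \<rho> i * cos (\<eta> i) \<and> A $ i $ k = \<rho> i * sin (\<eta> i)"
    by metis
  \<comment> \<open>The angles are doubled because \<open>cos\<^sup>2 - sin\<^sup>2\<close> at
    \<open>\<eta> i - t / 2\<close> is the cosine of \<open>2 * \<eta> i - t\<close>.\<close>
  obtain t where t: "(\<Sum>i\<in>UNIV. (\<rho> i)\<^sup>2) \<le>
      (\<Sum>i\<in>UNIV. (\<rho> i)\<^sup>2 * \<bar>cos (2 * \<eta> i - t)\<bar>) * (real CARD('m) * sin (pi / (2 * real CARD('m))))"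
    using ex_direction_sum_abs_cos_ge[of UNIV "\<lambda>i. (\<rho> i)\<^sup>2" "\<lambda>i. 2 * \<eta> i"] by auto
  define v :: "real^'d" where "v = cos (t / 2) *\<^sub>R axis j 1 + sin (t / 2) *\<^sub>R axis k 1"
  define w :: "real^'d" where "w = - sin (t / 2) *\<^sub>R axis j 1 + cos (t / 2) *\<^sub>R axis k 1"
  have norms: "norm v = 1" "norm w = 1"
    using jk sin_cos_squared_add3[of "t / 2"]
    by (simp_all add: v_def w_def norm_eq_1 inner_simps inner_axis_axis algebra_simps)
  have Ax: "(A *v axis j 1) $ i = \<rho> i * cos (\<eta> i)" "(A *v axis k 1) $ i = \<rho> i * sin (\<eta> i)" for i
    using polar by (simp_all add: matrix_vector_mult_basis column_def)
  have pv: "(A *v v) $ i = \<rho> i * cos (\<eta> i - t / 2)" for i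
    by (simp add: v_def matrix_vector_right_distrib matrix_vector_mult_scaleR Ax cos_diff algebra_simps)
  have pw: "(A *v w) $ i = \<rho> i * sin (\<eta> i - t / 2)" for i
    by (simp add: w_def matrix_vector_right_distrib matrix_vector_mult_scaleR
        matrix_vector_mult_diff_distrib Ax sin_diff algebra_simps)
  have sum: "((A *v v) $ i)\<^sup>2 + ((A *v w) $ i)\<^sup>2 = (\<rho> i)\<^sup>2" for i
    unfolding pv pw by (simp add: power_mult_distrib distrib_left[symmetric])
  have diff: "\<bar>((A *v v) $ i)\<^sup>2 - ((A *v w) $ i)\<^sup>2\<bar> = (\<rho> i)\<^sup>2 * \<bar>cos (2 * \<eta> i - t)\<bar>" for i
  proof -
    have "((A *v v) $ i)\<^sup>2 - ((A *v w) $ i)\<^sup>2 = (\<rho> i)\<^sup>2 * cos (2 * (\<eta> i - t / 2))"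
      unfolding pv pw cos_double by (simp add: power_mult_distrib right_diff_distrib)
    then show ?thesis by (simp add: abs_mult right_diff_distrib)
  qed
  show ?thesis
    by (rule that[OF norms]) (use t in \<open>simp add: sum diff\<close>)
qed

theorem theorem3p2:
  fixes A :: "real^'d^'m"
  assumes "CARD('d) \<ge> 2" and "CARD('m) \<ge> 3"
  shows "cond_number A \<ge>
    ereal (1 / sqrt (1 - 1 / (real CARD('m) * sin (pi / (2 * real CARD('m))))))"
proof -
  define s where "s = real CARD('m) * sin (pi / (2 * real CARD('m)))"
  have "0 < sin (pi / (2 * real CARD('m)))"
    using assms(2) by (intro sin_gt_zero) (auto simp: field_simps)
  then have s: "0 < s" using assms(2) by (simp add: s_def)
  obtain v w :: "real^'d" where vw: "norm v = 1" "norm w = 1"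
    and large: "(\<Sum>i\<in>UNIV. ((A *v v) $ i)\<^sup>2 + ((A *v w) $ i)\<^sup>2) \<le>
      (\<Sum>i\<in>UNIV. \<bar>((A *v v) $ i)\<^sup>2 - ((A *v w) $ i)\<^sup>2\<bar>) * s"
    by (rule ex_orthonormal_sum_abs_diff_ge[OF assms(1), of A, folded s_def])
  define T where "T = (\<Sum>i\<in>UNIV. ((A *v v) $ i)\<^sup>2 + ((A *v w) $ i)\<^sup>2)"
  define E where "E = (\<Sum>i\<in>UNIV. \<bar>((A *v v) $ i)\<^sup>2 - ((A *v w) $ i)\<^sup>2\<bar>)"
  have lower: "lower_lip A \<le> ereal (sqrt ((T - E) / 2))"
    using lower_lip_le_orthonormal[OF vw, of A] by (simp add: T_def E_def sum_subtractf)
  have T: "T = (norm (A *v v))\<^sup>2 + (norm (A *v w))\<^sup>2"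
    by (simp add: T_def norm_vec_def L2_set_def sum_nonneg sum.distrib)
  have upper: "ereal (sqrt (T / 2)) \<le> upper_lip A"
  proof -
    \<comment> \<open>The larger of the two squared norms is at least their mean
      \<open>T / 2\<close>.\<close>
    define M where "M = max (norm (A *v v)) (norm (A *v w))"
    have "(norm (A *v v))\<^sup>2 \<le> M\<^sup>2" "(norm (A *v w))\<^sup>2 \<le> M\<^sup>2" "0 \<le> M"
      by (auto simp: M_def le_max_iff_disj intro!: power_mono)
    then have "T / 2 \<le> M\<^sup>2" "0 \<le> M" using T by linarith+
    then have "sqrt (T / 2) \<le> M" by (intro real_le_lsqrt)
    moreover have "ereal M \<le> upper_lip A"
      using vw by (simp add: M_def max_def norm_matrix_vector_le_upper_lip)
    ultimately show ?thesis using order_trans ereal_less_eq(3) by blast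
  qed
  have "T / s \<le> E" using large s by (simp add: T_def E_def pos_divide_le_eq)
  then have gap: "(T - E) / 2 \<le> T / 2 * (1 - 1 / s)" by (simp add: right_diff_distrib diff_divide_distrib)
  have "1 / sqrt (1 - 1 / s) \<le> sqrt (T / 2) / sqrt ((T - E) / 2)" if "0 < sqrt ((T - E) / 2)"
  proof -
    have pos: "0 < (T - E) / 2" using that by simp
    have "0 \<le> T" by (simp add: T)
    \<comment> \<open>A positive lower bound forces this product to be positive, and with
      \<open>0 \<le> T\<close> also its second factor.\<close>
    have "0 < T / 2 * (1 - 1 / s)" using pos gap by linarith
    then have "0 < 1 - 1 / s" using \<open>0 \<le> T\<close> by (simp add: zero_less_mult_iff)
    moreover have "sqrt ((T - E) / 2) \<le> sqrt (T / 2) * sqrt (1 - 1 / s)"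
      using gap by (simp only: real_sqrt_mult[symmetric] real_sqrt_le_iff)
    ultimately show ?thesis using that by (simp add: divide_le_eq pos_le_divide_eq mult.commute)
  qed
  then show ?thesis
    using cond_number_ge[OF lower upper, of "1 / sqrt (1 - 1 / s)"] T unfolding s_def by simp
qed

end
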